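(* For every integer $m \geq 0$, $$E_m = \sum_{n=0}^m C_n (-1)^n 2^{m-2n}\, n!\, S_2(m,n).$$
   Context: The Euler numbers $E_n$ are defined by $\frac{2}{e^t+1} = \sum_{n\ge 0} E_n \frac{t^n}{n!}$. $C_n = \frac{1}{n+1}\binom{2n}{n}$ is the $n$-th Catalan number. The Stirling numbers of the second kind $S_2(n,l)$ are defined by $x^n = \sum_{l=0}^n S_2(n,l)(x)_l$, where $(x)_l = x(x-1)\cdots(x-l+1)$. *)

theory Defs
  imports "HOL-Computational_Algebra.Formal_Power_Series" "HOL-Combinatorics.Stirling"
begin

text \<open>The normalisation is the one with exponential generating function \<open>2 / (e\<^sup>t + 1)\<close>
  (values at \<open>0\<close> of the Euler polynomials), not the one with \<open>1 / cosh t\<close>.\<close>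

definition euler_number :: "nat \<Rightarrow> real" where
  "euler_number n = fact n * fps_nth (2 / (fps_exp 1 + 1)) n"

lemma euler_number_egf:
  "Abs_fps (\<lambda>n. euler_number n / fact n) * (fps_exp 1 + 1) = 2"
proof -
  have "Abs_fps (\<lambda>n. euler_number n / fact n) = 2 / (fps_exp 1 + 1)"
    by (rule fps_ext) (simp add: euler_number_def)
  moreover have "is_unit (fps_exp 1 + 1 :: real fps)"
    by (simp add: fps_is_unit_iff)
  ultimately show ?thesis
    by (metis dvd_div_mult_self unit_imp_dvd)
qed

definition catalan :: "nat \<Rightarrow> real" where
  "catalan n = 1 / (real n + 1) * real (2 * n choose n)"

definition falling_factorial :: "'a :: comm_ring_1 \<Rightarrow> nat \<Rightarrow> 'a" where
  "falling_factorial x l = (\<Prod>i<l. x - of_nat i)"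

text \<open>The numbers \<open>Stirling n l\<close> of the library, introduced there by their recurrence, are the
  coefficients of \<open>x\<^sup>n\<close> in the basis of falling factorials.\<close>

lemma power_eq_sum_Stirling_falling_factorial:
  fixes x :: "'a :: comm_ring_1"
  shows "x ^ n = (\<Sum>l\<le>n. of_nat (Stirling n l) * falling_factorial x l)"
proof (induction n)
  case 0
  show ?case by (simp add: falling_factorial_def)
next
  case (Suc n)
  have step: "x * falling_factorial x l = falling_factorial x (Suc l) + of_nat l * falling_factorial x l" for l
    by (simp add: falling_factorial_def algebra_simps)
  have "x ^ Suc n = (\<Sum>l\<le>n. of_nat (Stirling n l) * (x * falling_factorial x l))"
    by (simp add: Suc.IH sum_distrib_left algebra_simps)
  also have "\<dots> = (\<Sum>l\<le>n. of_nat (Stirling n l) * falling_factorial x (Suc l))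
      + (\<Sum>l\<le>n. of_nat (l * Stirling n l) * falling_factorial x l)"
    by (simp add: step sum.distrib algebra_simps)
  also have "(\<Sum>l\<le>n. of_nat (l * Stirling n l) * falling_factorial x l)
      = (\<Sum>l\<le>Suc n. of_nat (l * Stirling n l) * falling_factorial x l)"
    by (simp add: Stirling_less)
  also have "\<dots> = (\<Sum>l\<le>n. of_nat (Suc l * Stirling n (Suc l)) * falling_factorial x (Suc l))"
    by (subst sum.atMost_Suc_shift) simp
  also have "(\<Sum>l\<le>n. of_nat (Stirling n l) * falling_factorial x (Suc l)) + \<dots>
      = (\<Sum>l\<le>n. of_nat (Stirling (Suc n) (Suc l)) * falling_factorial x (Suc l))"
    by (simp add: sum.distrib [symmetric] algebra_simps)
  also have "\<dots> = (\<Sum>l\<le>Suc n. of_nat (Stirling (Suc n) l) * falling_factorial x l)"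
    by (subst sum.atMost_Suc_shift) simp
  finally show ?case .
qed

end

theory Submission
  imports Defs
begin

text \<open>By the generating function of the columns of the Stirling triangle, the right-hand side is
  the \<open>m\<close>-th coefficient, times \<open>m!\<close>, of \<open>D (e\<^bsup>2t\<^esup> - 1)\<close>, where
  \<open>D(y) = \<Sum>n. C\<^sub>n (- y / 4)\<^sup>n\<close>. The binomial series gives \<open>y D(y) / 2 = (1 + y)\<^bsup>1/2\<^esup> - 1\<close>,
  which at \<open>y = e\<^bsup>2t\<^esup> - 1\<close> is \<open>e\<^sup>t - 1\<close>. Cancelling this factor leaves \<open>2 / (e\<^sup>t + 1)\<close>.\<close>

text \<open>Since \<open>F = fps_exp c - 1\<close> satisfies \<open>F' = c * (F + 1)\<close>, the
  derivative of \<open>F ^ n\<close> is \<open>c * n * (F ^ n + F ^ (n - 1))\<close> for positive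
  \<open>n\<close>. Comparing coefficients gives the Stirling recurrence, scaled by
  \<open>c ^ m * fact n\<close>.\<close>

lemma fps_exp_minus_one_power_nth:
  fixes c :: "'a :: field_char_0"
  shows "fact m * fps_nth ((fps_exp c - 1) ^ n) m = c ^ m * fact n * of_nat (Stirling m n)"
proof (induction m arbitrary: n)
  case 0
  show ?case by (cases n) (simp_all add: fps_power_zeroth)
next
  case (Suc m)
  show ?case
  proof (cases n)
    case 0
    then show ?thesis by simp
  next
    case (Suc k)
    let ?F = "fps_exp c - 1 :: 'a fps"
    have deriv: "fps_deriv (?F ^ n) = fps_const (c * of_nat n) * (?F ^ n + ?F ^ k)"
    proof -
      have "fps_deriv (?F ^ n) = fps_const (of_nat n) * (fps_const c * fps_exp c) * ?F ^ k"
        by (subst fps_deriv_power) (simp add: Suc del: power_Suc)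
      also have "\<dots> = fps_const (of_nat n) * fps_const c * ((?F + 1) * ?F ^ k)"
        by (simp add: mult.assoc)
      also have "\<dots> = fps_const (c * of_nat n) * (?F ^ n + ?F ^ k)"
        unfolding Suc power_Suc fps_const_mult[symmetric] by algebra
      finally show ?thesis .
    qed
    have "fact (Suc m) * fps_nth (?F ^ n) (Suc m) = fact m * fps_nth (fps_deriv (?F ^ n)) m"
      by (simp add: algebra_simps)
    also have "\<dots> = c * of_nat n * (fact m * fps_nth (?F ^ n) m + fact m * fps_nth (?F ^ k) m)"
      unfolding deriv by (simp add: algebra_simps)
    also have "\<dots> = c ^ Suc m * fact n * of_nat (Stirling (Suc m) n)"
      unfolding Suc.IH using Suc by (simp add: algebra_simps)
    finally show ?thesis .
  qed
qed

text \<open>Ratio of consecutive Catalan numbers without division, to be matched with that of the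
  coefficients of the binomial series.\<close>

lemma catalan_Suc: "(real n + 2) * catalan (Suc n) = 2 * (2 * real n + 1) * catalan n"
proof -
  have 1: "catalan n = fact (2 * n) / ((real n + 1) * (fact n * fact n))"
    unfolding catalan_def by (simp add: binomial_fact)
  have "catalan (Suc n) = fact (2 * Suc n) / ((real n + 2) * (fact (Suc n) * fact (Suc n)))"
    unfolding catalan_def by (subst binomial_fact) (simp_all del: fact_Suc)
  also have "(fact (2 * Suc n) :: real) = 2 * (real n + 1) * (2 * real n + 1) * fact (2 * n)"
    by (simp add: algebra_simps)
  also have "(fact (Suc n) :: real) = (real n + 1) * fact n"
    by simp
  finally have 2: "catalan (Suc n) = 2 * (real n + 1) * (2 * real n + 1) * fact (2 * n) /
      ((real n + 2) * ((real n + 1) * fact n * ((real n + 1) * fact n)))" .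
  show ?thesis
    unfolding 1 2 by (simp add: divide_simps) (simp add: algebra_simps)
qed

text \<open>Both sides obey the same first-order recurrence, because
  \<open>1/2 - (n + 1) = (-1/4) * 2 * (2 * n + 1)\<close>.\<close>

lemma half_gchoose_Suc: "(1 / 2 gchoose Suc n) = catalan n * (-1 / 4) ^ n / (2 :: real)"
proof (induction n)
  case 0
  show ?case by (simp add: catalan_def)
next
  case (Suc n)
  have "(real n + 2) * (1 / 2 gchoose Suc (Suc n)) = (1 / 2 - real (Suc n)) * (1 / 2 gchoose Suc n)"
    using gbinomial_mult_1[of "1 / 2 :: real" "Suc n"] by (simp add: algebra_simps)
  also have "\<dots> = (-1 / 4) ^ Suc n / 2 * (2 * (2 * real n + 1) * catalan n)"
    unfolding Suc.IH by (simp add: field_simps)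
  also have "\<dots> = (real n + 2) * (catalan (Suc n) * (-1 / 4) ^ Suc n / 2)"
    unfolding catalan_Suc[symmetric] by (simp only: mult_ac times_divide_eq_right times_divide_eq_left)
  finally show ?case
    by (simp only: mult_cancel_left) linarith
qed

lemma catalan_fps_eq_binomial:
  "fps_X * Abs_fps (\<lambda>n. catalan n * (-1 / 4) ^ n) = 2 * (fps_binomial (1 / 2) - 1)"
proof (rule fps_ext)
  fix n
  show "fps_nth (fps_X * Abs_fps (\<lambda>n. catalan n * (-1 / 4) ^ n)) n =
      fps_nth (2 * (fps_binomial (1 / 2) - 1)) n"
    by (cases n) (simp_all add: half_gchoose_Suc numeral_fps_const del: power_Suc)
qed

text \<open>Both series are square roots of \<open>fps_exp 2\<close>, so they agree up to sign; the
  constant term 1 decides the sign.\<close>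

lemma fps_binomial_half_compose_exp: "fps_binomial (1 / 2) oo (fps_exp 2 - 1) = fps_exp (1 :: real)"
proof -
  let ?B = "fps_binomial (1 / 2) oo (fps_exp 2 - 1) :: real fps"
  have "fps_binomial (1 / 2) ^ 2 = (1 + fps_X :: real fps)"
    unfolding power2_eq_square fps_binomial_add_mult[symmetric] by (simp add: fps_binomial_1)
  then have "?B ^ 2 = (1 + fps_X) oo (fps_exp 2 - 1)"
    by (simp add: fps_compose_power)
  also have "\<dots> = fps_exp 1 ^ 2"
    by (simp add: fps_compose_add_distrib fps_exp_power_mult)
  finally have "?B = fps_exp 1 \<or> ?B = - fps_exp 1"
    by (simp only: power2_eq_iff)
  moreover have "fps_nth ?B 0 \<noteq> fps_nth (- fps_exp 1) 0"
    by simp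
  ultimately show ?thesis by metis
qed

lemma catalan_fps_compose_exp:
  "Abs_fps (\<lambda>n. catalan n * (-1 / 4) ^ n) oo (fps_exp 2 - 1) = 2 / (fps_exp 1 + 1)"
proof -
  let ?D = "Abs_fps (\<lambda>n. catalan n * (-1 / 4) ^ n)"
  let ?G = "?D oo (fps_exp 2 - 1)"
  have "(fps_exp 2 - 1) * ?G = (fps_X * ?D) oo (fps_exp 2 - 1)"
    by (simp add: fps_compose_mult_distrib)
  also have "\<dots> = 2 * (fps_exp 1 - 1)"
    unfolding catalan_fps_eq_binomial
    by (simp add: fps_compose_mult_distrib fps_compose_sub_distrib fps_binomial_half_compose_exp
        numeral_fps_const)
  finally have "(fps_exp 2 - 1) * ?G = 2 * (fps_exp 1 - 1)" .
  moreover have "fps_exp 2 - 1 = (fps_exp 1 - 1) * (fps_exp (1 :: real) + 1)"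
    by (simp add: algebra_simps flip: fps_exp_add_mult)
  ultimately have "(fps_exp 1 - 1) * (?G * (fps_exp 1 + 1)) = (fps_exp 1 - 1) * 2"
    by (simp only: mult_ac)
  \<comment> \<open>This factor has constant term 0, so it is not a unit; it can be cancelled
    because power series over a field have no zero divisors. Its linear coefficient is 1.\<close>
  moreover have "fps_exp 1 - 1 \<noteq> (0 :: real fps)"
  proof
    assume "fps_exp 1 - 1 = (0 :: real fps)"
    then have "fps_nth (fps_exp 1 - 1) 1 = fps_nth (0 :: real fps) 1" by simp
    then show False by simp
  qed
  ultimately have "?G * (fps_exp 1 + 1) = 2"
    by (simp only: mult_cancel_left) simp
  moreover have "fps_exp 1 + 1 \<noteq> (0 :: real fps)"
    using calculation by force
  ultimately show ?thesis
    by (metis nonzero_mult_div_cancel_right)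
qed

theorem theorem6:
  fixes m :: nat
  shows "euler_number m =
    (\<Sum>n=0..m. catalan n * (-1) ^ n * 2 powi (int m - 2 * int n) * fact n * real (Stirling m n))"
proof -
  have "euler_number m =
      (\<Sum>n=0..m. catalan n * (-1 / 4) ^ n * (fact m * fps_nth ((fps_exp 2 - 1) ^ n) m))"
    \<comment> \<open>The range \<open>0..m\<close> comes from \<open>fps_compose_nth\<close>:
      coefficient \<open>m\<close> of a composition is a sum over the powers up to
      \<open>m\<close>.\<close>
    unfolding euler_number_def catalan_fps_compose_exp[symmetric] fps_compose_nth
    by (simp add: sum_distrib_left mult_ac)
  also have "\<dots> =
      (\<Sum>n=0..m. catalan n * (-1) ^ n * 2 powi (int m - 2 * int n) * fact n * real (Stirling m n))"
  proof (rule sum.cong)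
    fix n
    \<comment> \<open>The exponent is negative when \<open>2 * n > m\<close>, hence
      \<open>powi\<close>. Here \<open>2 ^ m\<close> is the factor \<open>c ^ m\<close> with
      \<open>c = 2\<close>, and \<open>2 ^ (2 * n)\<close> is the denominator of
      \<open>(-1 / 4) ^ n\<close>.\<close>
    have "2 powi (int m - 2 * int n) = (2 :: real) ^ m / 2 ^ (2 * n)"
      using power_int_diff[of "2 :: real" "int m" "int (2 * n)"] by (simp flip: power_int_of_nat)
    moreover have "(-1 / 4 :: real) ^ n = (-1) ^ n / 4 ^ n"
      by (rule power_divide)
    ultimately have "(-1 / 4 :: real) ^ n * 2 ^ m = (-1) ^ n * 2 powi (int m - 2 * int n)"
      by (simp add: power_mult)
    then have "catalan n * ((-1 / 4) ^ n * 2 ^ m) * fact n * real (Stirling m n) =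
        catalan n * ((-1) ^ n * 2 powi (int m - 2 * int n)) * fact n * real (Stirling m n)"
      by (simp only:)
    then show "catalan n * (-1 / 4) ^ n * (fact m * fps_nth ((fps_exp 2 - 1) ^ n) m) =
        catalan n * (-1) ^ n * 2 powi (int m - 2 * int n) * fact n * real (Stirling m n)"
      unfolding fps_exp_minus_one_power_nth by (simp only: mult_ac)
  qed simp
  finally show ?thesis .
qed

end
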